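(* Let $n\ge 1$, let $\beta>0$ be fixed, and let $\alpha_k,\alpha^*_k>0$ for $k=1,\ldots,n$. Let $X_1,\ldots,X_n$ be independent random variables with $X_k\sim \mathcal{LFR}(\alpha_k,\beta)$, and let $Y_1,\ldots,Y_n$ be independent random variables with $Y_k\sim \mathcal{LFR}(\alpha^*_k,\beta)$, $k=1,\ldots,n$. If $\alpha_k\ge\alpha^*_k$ for every $k=1,\ldots,n$, then $X_{1:n}\le_{lr}Y_{1:n}$.
   Context: For $\alpha,\beta>0$, a random variable $X$ has the linear failure rate distribution, written $X\sim\mathcal{LFR}(\alpha,\beta)$, if its cumulative distribution function is $F_X(x)=1-\exp\{-(\alpha x+\frac{\beta}{2}x^2)\}$ for $x>0$ (and $0$ for $x\le 0$), so that its density is $f_X(x)=(\alpha+\beta x)\exp\{-(\alpha x+\frac{\beta}{2}x^2)\}$ for $x>0$. $X_{1:n}=\min\{X_1,\ldots,X_n\}$ and $Y_{1:n}=\min\{Y_1,\ldots,Y_n\}$ denote the smallest order statistics (lifetimes of series systems). For nonnegative absolutely continuous random variables $X,Y$ with densities $f_X,g_Y$, the likelihood ratio order $X\le_{lr}Y$ means that $g_Y(x)/f_X(x)$ is increasing (i.e. non-decreasing) in $x>0$. *)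

theory Defs
  imports "HOL-Probability.Probability"
begin

definition lfr_cdf :: "real \<Rightarrow> real \<Rightarrow> real \<Rightarrow> real" where
  "lfr_cdf \<alpha> \<beta> x = (if x \<le> 0 then 0 else 1 - exp (- (\<alpha> * x + \<beta> / 2 * x\<^sup>2)))"

definition has_LFR :: "'a measure \<Rightarrow> ('a \<Rightarrow> real) \<Rightarrow> real \<Rightarrow> real \<Rightarrow> bool" where
  "has_LFR M X \<alpha> \<beta> \<longleftrightarrow>
     X \<in> borel_measurable M \<and> (\<forall>x. cdf (distr M borel X) x = lfr_cdf \<alpha> \<beta> x)"

definition smallest_order_stat :: "nat \<Rightarrow> (nat \<Rightarrow> 'a \<Rightarrow> real) \<Rightarrow> 'a \<Rightarrow> real" where
  "smallest_order_stat n X \<omega> = (MIN k\<in>{1..n}. X k \<omega>)"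

(* Densities are determined only up to null sets, so the order asks for some
   versions f of the density of X and g of the density of Y. The ratio is formed
   in ennreal, so that it is infinite where f vanishes and g does not; points
   where both densities vanish, at which 0 / 0 would be 0, are left out.
   The two variables may live on different probability spaces. *)
definition lr_le ::
  "'a measure \<Rightarrow> ('a \<Rightarrow> real) \<Rightarrow> 'b measure \<Rightarrow> ('b \<Rightarrow> real) \<Rightarrow> bool" where
  "lr_le M X N Y \<longleftrightarrow>
     (AE \<omega> in M. 0 \<le> X \<omega>) \<and> (AE \<omega> in N. 0 \<le> Y \<omega>) \<and>
     (\<exists>f g :: real \<Rightarrow> real.
        (\<forall>x. 0 \<le> f x) \<and> (\<forall>x. 0 \<le> g x) \<and>
        distributed M lborel X (\<lambda>x. ennreal (f x)) \<and>
        distributed N lborel Y (\<lambda>x. ennreal (g x)) \<and>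
        mono_on {x. 0 < x \<and> (f x \<noteq> 0 \<or> g x \<noteq> 0)} (\<lambda>x. ennreal (g x) / ennreal (f x)))"

end

(* With a common beta, the minimum of independent LFR(alpha k, beta) variables is again
   LFR, with parameters A = sum of the alpha k and B = n * beta: the survival functions
   multiply. The likelihood ratio of two such minima is
   (A' + B x) / (A + B x) * exp ((A - A') x), a product of two nonnegative factors that
   are both non-decreasing in x > 0 when A' <= A. *)
theory Submission
  imports Defs
begin

definition lfr_density :: "real \<Rightarrow> real \<Rightarrow> real \<Rightarrow> real" where
  "lfr_density \<alpha> \<beta> x =
     (if x \<le> 0 then 0 else (\<alpha> + \<beta> * x) * exp (- (\<alpha> * x + \<beta> / 2 * x\<^sup>2)))"

lemma lfr_density_nonneg: "0 \<le> \<alpha> \<Longrightarrow> 0 \<le> \<beta> \<Longrightarrow> 0 \<le> lfr_density \<alpha> \<beta> x"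
  by (simp add: lfr_density_def)

lemma lfr_density_pos: "0 < \<alpha> \<Longrightarrow> 0 \<le> \<beta> \<Longrightarrow> 0 < x \<Longrightarrow> 0 < lfr_density \<alpha> \<beta> x"
  by (simp add: lfr_density_def add_pos_nonneg)

lemma borel_measurable_lfr_density [measurable]: "lfr_density \<alpha> \<beta> \<in> borel_measurable borel"
  unfolding lfr_density_def by measurable

text \<open>On the positive half line the density is the derivative of
  \<open>- exp (- (\<alpha> * x + \<beta> / 2 * x\<^sup>2))\<close>, so the fundamental theorem of
  calculus on \<open>{0..a}\<close> gives the distribution function.\<close>

lemma nn_integral_lfr_density:
  assumes "0 \<le> \<alpha>" "0 \<le> \<beta>"
  shows "(\<integral>\<^sup>+x. ennreal (lfr_density \<alpha> \<beta> x * indicator {..a} x) \<partial>lborel)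
           = ennreal (lfr_cdf \<alpha> \<beta> a)"
proof (cases "a \<le> 0")
  case True
  then have "(\<integral>\<^sup>+x. ennreal (lfr_density \<alpha> \<beta> x * indicator {..a} x) \<partial>lborel)
      = (\<integral>\<^sup>+x. 0 \<partial>(lborel :: real measure))"
    by (intro nn_integral_cong) (auto simp: lfr_density_def indicator_def)
  then show ?thesis
    using True by (simp add: lfr_cdf_def)
next
  case False
  let ?d = "\<lambda>x. (\<alpha> + \<beta> * x) * exp (- (\<alpha> * x + \<beta> / 2 * x\<^sup>2))"
  let ?F = "\<lambda>x. - exp (- (\<alpha> * x + \<beta> / 2 * x\<^sup>2))"
  have "(\<integral>\<^sup>+x. ennreal (lfr_density \<alpha> \<beta> x * indicator {..a} x) \<partial>lborel)
      = (\<integral>\<^sup>+x. ennreal (?d x) * indicator {0..a} x \<partial>lborel)"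
    \<comment> \<open>The integrands may differ at 0, where \<open>lfr_density\<close> is 0 but
      \<open>?d\<close> is \<alpha>; hence equality only almost everywhere.\<close>
    using AE_lborel_singleton[of 0]
    by (intro nn_integral_cong_AE, eventually_elim)
       (auto simp: lfr_density_def indicator_def)
  also have "\<dots> = ennreal (?F a - ?F 0)"
  proof (rule nn_integral_FTC_Icc)
    show "(?F has_real_derivative ?d x) (at x)" for x
      by (auto intro!: derivative_eq_intros simp: algebra_simps)
  qed (use False assms in auto)
  finally show ?thesis
    using False by (simp add: lfr_cdf_def)
qed

text \<open>A law on the reals is determined by its values on the half lines \<open>{..a}\<close>,
  so the integral computed above identifies the density.\<close>

lemma (in prob_space) distributed_lfr_density:
  assumes "0 \<le> \<alpha>" "0 \<le> \<beta>" and X: "has_LFR M X \<alpha> \<beta>"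
  shows "distributed M lborel X (lfr_density \<alpha> \<beta>)"
proof (rule distributedI_borel_atMost)
  show [measurable]: "X \<in> borel_measurable M"
    using X by (simp add: has_LFR_def)
  show "emeasure M {\<omega> \<in> space M. X \<omega> \<le> a} = ennreal (lfr_cdf \<alpha> \<beta> a)" for a
  proof -
    have "cdf (distr M borel X) a = prob {\<omega> \<in> space M. X \<omega> \<le> a}"
      by (auto simp: cdf_def measure_distr intro!: arg_cong[where f = prob])
    then show ?thesis
      using X by (simp add: has_LFR_def emeasure_eq_measure)
  qed
qed (use assms nn_integral_lfr_density in \<open>auto simp: lfr_density_nonneg\<close>)

lemma (in prob_space) AE_nonneg_has_LFR:
  assumes X: "has_LFR M X \<alpha> \<beta>"
  shows "AE \<omega> in M. 0 \<le> X \<omega>"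
proof -
  have [measurable]: "X \<in> borel_measurable M"
    using X by (simp add: has_LFR_def)
  have "prob {\<omega> \<in> space M. X \<omega> \<le> 0} = cdf (distr M borel X) 0"
    by (auto simp: cdf_def measure_distr intro!: arg_cong[where f = prob])
  also have "\<dots> = 0"
    using X by (simp add: has_LFR_def lfr_cdf_def)
  finally have "AE \<omega> in M. \<not> X \<omega> \<le> 0"
    by (subst AE_iff_measurable[OF _ refl]) (simp_all add: emeasure_eq_measure)
  then show ?thesis
    by eventually_elim auto
qed

lemma (in prob_space) prob_gt_has_LFR:
  assumes X: "has_LFR M X \<alpha> \<beta>"
  shows "prob (X -` {a<..} \<inter> space M) = 1 - lfr_cdf \<alpha> \<beta> a"
proof -
  have [measurable]: "X \<in> borel_measurable M"
    using X by (simp add: has_LFR_def)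
  have "prob (X -` {a<..} \<inter> space M) = prob (space M - (X -` {..a} \<inter> space M))"
    by (auto intro!: arg_cong[where f = prob])
  also have "\<dots> = 1 - cdf (distr M borel X) a"
    by (subst prob_compl) (auto simp: cdf_def measure_distr)
  finally show ?thesis
    using X by (simp add: has_LFR_def)
qed

text \<open>The minimum exceeds a exactly when every \<open>X k\<close> does, so independence turns
  its survival function into a product. The exponents add up: the linear coefficients are summed,
  while the common quadratic one is counted n times.\<close>

lemma (in prob_space) has_LFR_smallest_order_stat:
  assumes n: "n \<ge> 1"
    and indep: "indep_vars (\<lambda>_. borel) X {1..n}"
    and X: "\<And>k. k \<in> {1..n} \<Longrightarrow> has_LFR M (X k) (\<alpha> k) \<beta>"
  shows "has_LFR M (smallest_order_stat n X) (\<Sum>k=1..n. \<alpha> k) (n * \<beta>)"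
proof -
  let ?m = "smallest_order_stat n X" and ?A = "\<Sum>k=1..n. \<alpha> k"
  have [measurable]: "X k \<in> borel_measurable M" if "k \<in> {1..n}" for k
    using X[OF that] by (simp add: has_LFR_def)
  have m [measurable]: "?m \<in> borel_measurable M"
    unfolding smallest_order_stat_def[abs_def] using n by measurable
  have "cdf (distr M borel ?m) a = lfr_cdf ?A (n * \<beta>) a" for a
  proof -
    have "cdf (distr M borel ?m) a = prob (space M - (?m -` {a<..} \<inter> space M))"
      by (auto simp: cdf_def measure_distr intro!: arg_cong[where f = prob])
    also have "\<dots> = 1 - prob (?m -` {a<..} \<inter> space M)"
      by (rule prob_compl) measurable
    \<comment> \<open>Since n \<ge> 1, the minimum is over a nonempty set and the intersection stays
      inside \<open>space M\<close>.\<close>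
    also have "?m -` {a<..} \<inter> space M = (\<Inter>k\<in>{1..n}. X k -` {a<..} \<inter> space M)"
      using n by (auto simp: smallest_order_stat_def)
    also have "prob \<dots> = (\<Prod>k=1..n. prob (X k -` {a<..} \<inter> space M))"
      using n by (intro indep_varsD_finite[OF indep]) auto
    also have "\<dots> = (\<Prod>k=1..n. 1 - lfr_cdf (\<alpha> k) \<beta> a)"
      by (intro prod.cong refl prob_gt_has_LFR X)
    also have "1 - \<dots> = lfr_cdf ?A (n * \<beta>) a"
    \<comment> \<open>For a \<le> 0 every factor is 1 and both sides are 0; only a > 0 needs the
      exponential formula.\<close>
    proof (cases "a \<le> 0")
      case False
      have "(\<Prod>k=1..n. exp (- (\<alpha> k * a + \<beta> / 2 * a\<^sup>2)))
          = exp (\<Sum>k=1..n. - (\<alpha> k * a + \<beta> / 2 * a\<^sup>2))"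
        by (simp add: exp_sum)
      also have "(\<Sum>k=1..n. - (\<alpha> k * a + \<beta> / 2 * a\<^sup>2)) = - (?A * a + n * \<beta> / 2 * a\<^sup>2)"
        by (simp add: sum_negf sum.distrib sum_distrib_right del: minus_add_distrib)
      finally show ?thesis
        using False by (simp add: lfr_cdf_def)
    qed (simp add: lfr_cdf_def)
    finally show ?thesis .
  qed
  with m show ?thesis
    by (simp add: has_LFR_def)
qed

lemma lfr_density_ratio_mono:
  assumes "0 < \<alpha>'" "\<alpha>' \<le> \<alpha>" "0 \<le> \<beta>" "0 < x" "x \<le> y"
  shows "lfr_density \<alpha>' \<beta> x / lfr_density \<alpha> \<beta> x \<le> lfr_density \<alpha>' \<beta> y / lfr_density \<alpha> \<beta> y"
proof -
  have pos: "0 < \<alpha> + \<beta> * t" if "0 < t" for t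
    using assms that by (intro add_pos_nonneg) auto
  \<comment> \<open>The common \<beta> makes the quadratic terms of the two exponents cancel,
    leaving a linear exponent with slope \<open>\<alpha> - \<alpha>'\<close> \<ge> 0.\<close>
  have ratio: "lfr_density \<alpha>' \<beta> t / lfr_density \<alpha> \<beta> t
      = (\<alpha>' + \<beta> * t) / (\<alpha> + \<beta> * t) * exp ((\<alpha> - \<alpha>') * t)" if "0 < t" for t
  proof -
    have "exp (- (\<alpha>' * t + \<beta> / 2 * t\<^sup>2)) / exp (- (\<alpha> * t + \<beta> / 2 * t\<^sup>2))
        = exp ((\<alpha> - \<alpha>') * t)"
      by (simp add: exp_diff[symmetric] algebra_simps)
    then show ?thesis
      using that by (simp add: lfr_density_def times_divide_times_eq[symmetric])
  qed
  \<comment> \<open>This is what remains of the inequality between the rational factors after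
    cross-multiplying and cancelling equal terms.\<close>
  have "\<beta> * x * (\<alpha> - \<alpha>') \<le> \<beta> * y * (\<alpha> - \<alpha>')"
    using assms by (intro mult_right_mono mult_left_mono) auto
  then have "(\<alpha>' + \<beta> * x) / (\<alpha> + \<beta> * x) \<le> (\<alpha>' + \<beta> * y) / (\<alpha> + \<beta> * y)"
    using pos[of x] pos[of y] assms by (simp add: frac_le_eq divide_le_0_iff algebra_simps)
  moreover have "exp ((\<alpha> - \<alpha>') * x) \<le> exp ((\<alpha> - \<alpha>') * y)"
    using assms by (simp add: mult_left_mono)
  ultimately show ?thesis
    using assms pos[of y] by (simp only: ratio) (intro mult_mono, auto)
qed

text \<open>The versions chosen for the densities are the two functions \<open>lfr_density\<close>.
  Both are strictly positive at every x > 0, so the \<open>ennreal\<close> quotient is there an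
  ordinary real quotient and the real monotonicity lemma applies.\<close>

lemma lr_le_has_LFR:
  assumes "prob_space M" "prob_space N"
    and "0 < \<alpha>'" "\<alpha>' \<le> \<alpha>" "0 \<le> \<beta>"
    and "has_LFR M X \<alpha> \<beta>" "has_LFR N Y \<alpha>' \<beta>"
  shows "lr_le M X N Y"
  unfolding lr_le_def
proof (intro conjI exI)
  have "0 < \<alpha>"
    using assms by simp
  show "mono_on {x. 0 < x \<and> (lfr_density \<alpha> \<beta> x \<noteq> 0 \<or> lfr_density \<alpha>' \<beta> x \<noteq> 0)}
          (\<lambda>x. ennreal (lfr_density \<alpha>' \<beta> x) / ennreal (lfr_density \<alpha> \<beta> x))"
    using assms \<open>0 < \<alpha>\<close>
    by (intro mono_onI)
       (auto simp: divide_ennreal lfr_density_nonneg lfr_density_pos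
             intro!: ennreal_leI lfr_density_ratio_mono)
qed (use assms in \<open>auto intro: prob_space.AE_nonneg_has_LFR prob_space.distributed_lfr_density
       lfr_density_nonneg\<close>)

theorem theorem3p3:
  fixes M :: "'a measure" and N :: "'b measure"
    and X :: "nat \<Rightarrow> 'a \<Rightarrow> real" and Y :: "nat \<Rightarrow> 'b \<Rightarrow> real"
    and \<alpha> \<alpha>' :: "nat \<Rightarrow> real" and \<beta> :: real and n :: nat
  assumes "prob_space M" and "prob_space N"
    and "n \<ge> 1" and "\<beta> > 0"
    and "\<And>k. k \<in> {1..n} \<Longrightarrow> \<alpha> k > 0"
    and "\<And>k. k \<in> {1..n} \<Longrightarrow> \<alpha>' k > 0"
    and "prob_space.indep_vars M (\<lambda>_. borel) X {1..n}"
    and "\<And>k. k \<in> {1..n} \<Longrightarrow> has_LFR M (X k) (\<alpha> k) \<beta>"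
    and "prob_space.indep_vars N (\<lambda>_. borel) Y {1..n}"
    and "\<And>k. k \<in> {1..n} \<Longrightarrow> has_LFR N (Y k) (\<alpha>' k) \<beta>"
    and "\<And>k. k \<in> {1..n} \<Longrightarrow> \<alpha> k \<ge> \<alpha>' k"
  shows "lr_le M (smallest_order_stat n X) N (smallest_order_stat n Y)"
\<comment> \<open>Both minima have the same second parameter \<open>n * \<beta>\<close>, so the
  comparison reduces to that of the sums of the first parameters.\<close>
proof (rule lr_le_has_LFR)
  show "has_LFR M (smallest_order_stat n X) (\<Sum>k=1..n. \<alpha> k) (n * \<beta>)"
    using assms by (intro prob_space.has_LFR_smallest_order_stat) auto
  show "has_LFR N (smallest_order_stat n Y) (\<Sum>k=1..n. \<alpha>' k) (n * \<beta>)"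
    using assms by (intro prob_space.has_LFR_smallest_order_stat) auto
  show "(\<Sum>k=1..n. \<alpha>' k) \<le> (\<Sum>k=1..n. \<alpha> k)"
    using assms by (intro sum_mono) auto
  show "0 < (\<Sum>k=1..n. \<alpha>' k)"
    using assms by (intro sum_pos) auto
qed (use assms in auto)

end
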